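(* Let $S=\langle d_0,d_1,d_2,d_3\rangle$ be a numerical semigroup with embedding dimension four, and suppose the coefficients of the minimal relations $a_{ii}d_i=\sum_{j\ne i}a_{ij}d_j$ ($i=1,2,3$) can be (and are) chosen such that at most one of $a_{10},a_{20},a_{30}$ equals $0$. Let $T$, $V$ and $U$ be as defined in the context. Then $\mathrm{Betti}(S)\subseteq U$.
   Context: $S$ is the set of nonnegative integer combinations of its minimal generators $d_0,\dots,d_3$ ($\gcd=1$); $\mathrm{Ap}(S,d_0)=\{s\in S:s-d_0\notin S\}$. For $i\in\{0,1,2,3\}$, $a_{ii}$ is the least positive integer with $a_{ii}d_i=\sum_{j\ne i}a_{ij}d_j$ for some $a_{ij}\in\mathbb N$ (minimal relations; the $a_{ij}$ are fixed). Cubes $[[i,j,k]]=[i,i+1]\times[j,j+1]\times[k,k+1]$, $(i,j,k)\in\mathbb N^3$, are labeled $id_1+jd_2+kd_3$; the initial collection consists of all of them. Deleting the region associated to $(a,b,c)\in\mathbb Z^3$ removes all cubes $[[i,j,k]]$ with $i\ge a,j\ge b,k\ge c$. Under the hypothesis, the set $T$ of cubes whose labels lie in $\mathrm{Ap}(S,d_0)$ and which satisfy $i<a_{11}$, $j<a_{22}$, $k<a_{33}$ contains exactly one cube labeled by each element of $\mathrm{Ap}(S,d_0)$. $V$ is a minimal set of points $(x,y,z)\in\mathbb Z^3$ such that $xd_1+yd_2+zd_3$ is a nonnegative multiple of $d_0$ and deleting from the initial collection the regions associated to the points of $V$ leaves exactly $T$. $U=\{\theta_1xd_1+\theta_2yd_2+\theta_3zd_3:(x,y,z)\in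 V\}$, where $\theta_1=1$ if $x\ge0$ and $0$ otherwise, and similarly $\theta_2,\theta_3$ for $y,z$. Factorizations: $\varphi:\mathbb N^4\to S$, $\varphi(z)=\sum z_id_i$; $\mathrm{supp}(z)=\{i:z_i>0\}$; $z,z'$ are $\mathcal R$-related if there is a sequence $z=z_1,\dots,z_p=z'$ in $\mathbb N^4$ with $\mathrm{supp}(z_i)\cap\mathrm{supp}(z_{i+1})\ne\emptyset$ for all $i$. $s\in S$ is a Betti element if $\varphi^{-1}(s)$ contains two elements that are not $\mathcal R$-related; $\mathrm{Betti}(S)$ is the set of Betti elements. *)

theory Defs
  imports Complex_Main "HOL-Library.Numeral_Type"
begin

text \<open>
  Generators are families \<open>d :: 'n \<Rightarrow> nat\<close> over a finite index type, and \<open>\<nat>\<^sup>n\<close> is \<open>'n \<Rightarrow> nat\<close>.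
  For embedding dimension four the index type is \<^typ>\<open>4\<close>, whose elements are \<open>0, 1, 2, 3\<close>.
\<close>

definition fact_map :: "('n::finite \<Rightarrow> nat) \<Rightarrow> ('n \<Rightarrow> nat) \<Rightarrow> nat" where
  "fact_map d z = (\<Sum>i\<in>UNIV. z i * d i)"

definition supp :: "('n \<Rightarrow> nat) \<Rightarrow> 'n set" where
  "supp z = {i. 0 < z i}"

text \<open>
  Minimality of the system of generators: no proper subfamily generates \<open>S\<close>. In particular the
  generators are positive and pairwise distinct.
\<close>

definition minimal_generators :: "('n::finite \<Rightarrow> nat) \<Rightarrow> nat set \<Rightarrow> bool" where
  "minimal_generators d S \<longleftrightarrow>
     S = range (fact_map d) \<and>
     (\<forall>I. I \<subset> UNIV \<longrightarrow> fact_map d ` {z. supp z \<subseteq> I} \<noteq> S)"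

definition numerical_semigroup_gens :: "('n::finite \<Rightarrow> nat) \<Rightarrow> nat set \<Rightarrow> bool" where
  "numerical_semigroup_gens d S \<longleftrightarrow> minimal_generators d S \<and> Gcd (range d) = 1"

definition Apery :: "nat set \<Rightarrow> nat \<Rightarrow> nat set" where
  "Apery S m = {s \<in> S. \<not> (m \<le> s \<and> s - m \<in> S)}"

definition minimal_relation :: "('n::finite \<Rightarrow> nat) \<Rightarrow> ('n \<Rightarrow> 'n \<Rightarrow> nat) \<Rightarrow> 'n \<Rightarrow> bool" where
  "minimal_relation d a i \<longleftrightarrow>
     0 < a i i \<and>
     a i i * d i = (\<Sum>j\<in>UNIV - {i}. a i j * d j) \<and>
     (\<forall>n c. 0 < n \<and> n * d i = (\<Sum>j\<in>UNIV - {i}. c j * d j) \<longrightarrow> a i i \<le> n)"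

text \<open>The cube \<open>[i,i+1] \<times> [j,j+1] \<times> [k,k+1]\<close> is represented by its corner \<open>(i, j, k)\<close>.\<close>

type_synonym cube = "nat \<times> nat \<times> nat"

definition cube_label :: "(4 \<Rightarrow> nat) \<Rightarrow> cube \<Rightarrow> nat" where
  "cube_label d = (\<lambda>(i, j, k). i * d 1 + j * d 2 + k * d 3)"

definition initial_cubes :: "cube set" where
  "initial_cubes = UNIV"

definition region :: "int \<times> int \<times> int \<Rightarrow> cube set" where
  "region = (\<lambda>(a, b, c). {(i, j, k). a \<le> int i \<and> b \<le> int j \<and> c \<le> int k})"

definition T_set :: "(4 \<Rightarrow> nat) \<Rightarrow> (4 \<Rightarrow> 4 \<Rightarrow> nat) \<Rightarrow> nat set \<Rightarrow> cube set" where
  "T_set d a S = {(i, j, k) \<in> initial_cubes.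
     cube_label d (i, j, k) \<in> Apery S (d 0) \<and> i < a 1 1 \<and> j < a 2 2 \<and> k < a 3 3}"

definition cuts_out :: "(4 \<Rightarrow> nat) \<Rightarrow> (int \<times> int \<times> int) set \<Rightarrow> cube set \<Rightarrow> bool" where
  "cuts_out d V T \<longleftrightarrow>
     (\<forall>(x, y, z) \<in> V. \<exists>m::nat. x * int (d 1) + y * int (d 2) + z * int (d 3) = int m * int (d 0)) \<and>
     initial_cubes - (\<Union>v\<in>V. region v) = T"

text \<open>
  Minimality is with respect to inclusion. Since \<open>\<nat>\<^sup>3\<close> is well-partially-ordered, such sets are
  exactly those of least cardinality.
\<close>

definition minimal_cuts_out :: "(4 \<Rightarrow> nat) \<Rightarrow> (int \<times> int \<times> int) set \<Rightarrow> cube set \<Rightarrow> bool" where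
  "minimal_cuts_out d V T \<longleftrightarrow> cuts_out d V T \<and> (\<forall>W. W \<subset> V \<longrightarrow> \<not> cuts_out d W T)"

definition theta :: "int \<Rightarrow> int" where
  "theta x = (if 0 \<le> x then 1 else 0)"

definition U_set :: "(4 \<Rightarrow> nat) \<Rightarrow> (int \<times> int \<times> int) set \<Rightarrow> int set" where
  "U_set d V = (\<lambda>(x, y, z). theta x * x * int (d 1) + theta y * y * int (d 2)
                            + theta z * z * int (d 3)) ` V"

text \<open>
  The chains defining \<open>\<R>\<close> run inside one fibre \<open>\<phi>\<inverse>(s)\<close> of the factorization map. (With chains
  through arbitrary elements of \<open>\<nat>\<^sup>n\<close>, any two nonzero elements would be related via the all-one
  vector, and there would be no Betti elements.)
\<close>

definition R_related :: "('n::finite \<Rightarrow> nat) \<Rightarrow> nat \<Rightarrow> ('n \<Rightarrow> nat) \<Rightarrow> ('n \<Rightarrow> nat) \<Rightarrow> bool" where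
  "R_related d s z z' \<longleftrightarrow>
     (\<exists>zs. zs \<noteq> [] \<and> hd zs = z \<and> last zs = z' \<and> set zs \<subseteq> fact_map d -` {s} \<and>
           successively (\<lambda>u v. supp u \<inter> supp v \<noteq> {}) zs)"

definition Betti :: "('n::finite \<Rightarrow> nat) \<Rightarrow> nat set \<Rightarrow> nat set" where
  "Betti d S = {s \<in> S. \<exists>z \<in> fact_map d -` {s}. \<exists>z' \<in> fact_map d -` {s}. \<not> R_related d s z z'}"

end

theory Submission
  imports Defs
begin

text \<open>
  The corners of the staircase \<open>T\<close>, i.e. the cubes outside \<open>T\<close> all of whose lower neighbours
  lie in \<open>T\<close>, must be the nonnegative parts of points of \<open>V\<close>, so their labels lie in \<open>U\<close>.
  Hence it suffices to find, for a Betti element \<open>s\<close>, a factorization of \<open>s\<close> not involving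
  \<open>d\<^sub>0\<close> which is such a corner. If \<open>s\<close> lies in the Apery set, then two \<open>\<R>\<close>-classes share the
  three indices \<open>1, 2, 3\<close>, so one of them involves a single index \<open>i\<close> and \<open>s = a\<^sub>i\<^sub>i d\<^sub>i\<close>.
  Otherwise some class involves \<open>d\<^sub>0\<close>; in another class, the exchange given by a minimal relation
  with \<open>a\<^sub>i\<^sub>0 > 0\<close> is impossible (except at \<open>a\<^sub>i\<^sub>i d\<^sub>i\<close> itself), as it would connect the two
  classes, and the at most one remaining relation is applied until its coordinate drops below \<open>a\<^sub>i\<^sub>i\<close>.
\<close>

section \<open>Factorizations\<close>

lemma fact_map_remove:
  "fact_map d z = z i * d i + (\<Sum>j\<in>UNIV - {i}. z j * d j)"
  unfolding fact_map_def by (rule sum.remove) auto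

lemma fact_map_upd_add: "fact_map d (z(i := z i + n)) = fact_map d z + n * d i"
proof -
  have "(\<Sum>j\<in>UNIV - {i}. (z(i := z i + n)) j * d j) = (\<Sum>j\<in>UNIV - {i}. z j * d j)"
    by (rule sum.cong) auto
  then show ?thesis
    by (simp add: fact_map_remove[of d _ i] algebra_simps)
qed

lemma fact_map_upd_diff:
  assumes "n \<le> z i"
  shows "fact_map d (z(i := z i - n)) + n * d i = fact_map d z"
  using fact_map_upd_add[of d "z(i := z i - n)" i n] assms by simp

text \<open>Adding or removing one copy of \<open>d k\<close> passes between factorizations of
  \<open>s - d k\<close> and those factorizations of \<open>s\<close> that use \<open>d k\<close>.
  This turns the Apery condition into one on the fibre of \<open>s\<close>, where R-classes
  live.\<close>

lemma Apery_range_iff: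
  "s \<in> Apery (range (fact_map d)) (d k) \<longleftrightarrow>
     s \<in> range (fact_map d) \<and> (\<forall>w. fact_map d w = s \<longrightarrow> w k = 0)"
proof -
  have "(d k \<le> s \<and> s - d k \<in> range (fact_map d)) \<longleftrightarrow> (\<exists>w. fact_map d w = s \<and> 0 < w k)"
  proof
    assume "d k \<le> s \<and> s - d k \<in> range (fact_map d)"
    then obtain w where "d k \<le> s" "s - d k = fact_map d w" by auto
    then have "fact_map d (w(k := w k + 1)) = s" by (simp only: fact_map_upd_add)
    then show "\<exists>w. fact_map d w = s \<and> 0 < w k"
      by (intro exI[of _ "w(k := w k + 1)"]) simp
  next
    assume "\<exists>w. fact_map d w = s \<and> 0 < w k"
    then obtain w where "fact_map d w = s" "0 < w k" by auto
    then have "fact_map d (w(k := w k - 1)) + d k = s"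
      using fact_map_upd_diff[of 1 w k d] by simp
    then show "d k \<le> s \<and> s - d k \<in> range (fact_map d)"
      by (metis add_diff_cancel_right' le_add2 rangeI)
  qed
  then show ?thesis by (auto simp: Apery_def)
qed

text \<open>A generator equal to 0 could be dropped without changing the semigroup.\<close>

lemma minimal_generators_pos:
  assumes "minimal_generators d S"
  shows "0 < d i"
proof (rule ccontr)
  assume "\<not> 0 < d i"
  then have "d i = 0" by simp
  have "fact_map d ` {z. supp z \<subseteq> UNIV - {i}} = S"
  proof
    show "fact_map d ` {z. supp z \<subseteq> UNIV - {i}} \<subseteq> S"
      using assms by (auto simp: minimal_generators_def)
    show "S \<subseteq> fact_map d ` {z. supp z \<subseteq> UNIV - {i}}"
    proof
      fix s assume "s \<in> S"
      then obtain z where "s = fact_map d z"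
        using assms by (auto simp: minimal_generators_def)
      then have "s = fact_map d (z(i := 0))"
        using fact_map_upd_diff[of "z i" z i d] \<open>d i = 0\<close> by simp
      moreover have "supp (z(i := 0)) \<subseteq> UNIV - {i}" by (auto simp: supp_def)
      ultimately show "s \<in> fact_map d ` {z. supp z \<subseteq> UNIV - {i}}" by blast
    qed
  qed
  moreover have "UNIV - {i} \<subset> UNIV" by auto
  ultimately show False using assms unfolding minimal_generators_def by blast
qed

section \<open>Exchanges along minimal relations\<close>

definition exchange :: "('n \<Rightarrow> 'n \<Rightarrow> nat) \<Rightarrow> 'n \<Rightarrow> ('n \<Rightarrow> nat) \<Rightarrow> 'n \<Rightarrow> nat" where
  "exchange a i z = (\<lambda>j. if j = i then z i - a i i else z j + a i j)"

lemma fact_map_exchange: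
  assumes "minimal_relation d a i" "a i i \<le> z i"
  shows "fact_map d (exchange a i z) = fact_map d z"
proof -
  have "(\<Sum>j\<in>UNIV - {i}. exchange a i z j * d j) = (\<Sum>j\<in>UNIV - {i}. z j * d j + a i j * d j)"
    by (rule sum.cong) (auto simp: exchange_def algebra_simps)
  also have "\<dots> = (\<Sum>j\<in>UNIV - {i}. z j * d j) + a i i * d i"
    using assms(1) by (simp add: sum.distrib minimal_relation_def)
  finally have "fact_map d (exchange a i z) = (z i - a i i) * d i + a i i * d i
      + (\<Sum>j\<in>UNIV - {i}. z j * d j)"
    by (simp add: fact_map_remove[of d _ i] exchange_def)
  also have "(z i - a i i) * d i + a i i * d i = z i * d i"
    using assms(2) by (metis add_mult_distrib le_add_diff_inverse2)
  finally show ?thesis by (simp add: fact_map_remove[of d z i])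
qed

text \<open>If \<open>z i\<close> exceeds \<open>a i i\<close>, index \<open>i\<close> survives the
  exchange; otherwise another positive coordinate of \<open>z\<close> exists and can only grow. So
  an exchange stays in the R-class, except possibly at the excluded multiple of a unit
  vector.\<close>

lemma supp_exchange_Int:
  assumes "a i i \<le> z i" "z \<noteq> (\<lambda>_. 0)(i := a i i)"
  shows "supp z \<inter> supp (exchange a i z) \<noteq> {}"
proof (cases "z i = a i i")
  case True
  then obtain j where "j \<noteq> i" "0 < z j"
    using assms(2) by (auto simp: fun_eq_iff split: if_splits)
  then show ?thesis by (auto simp: supp_def exchange_def)
next
  case False
  then have "i \<in> supp z \<inter> supp (exchange a i z)"
    using assms(1) by (simp add: supp_def exchange_def)
  then show ?thesis by auto
qed

section \<open>R-relatedness as an equivalence relation on each fibre\<close>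

lemma R_related_step:
  assumes "fact_map d u = s" "fact_map d v = s" "supp u \<inter> supp v \<noteq> {}"
  shows "R_related d s u v"
  unfolding R_related_def using assms by (intro exI[of _ "[u, v]"]) simp

lemma R_related_refl: "fact_map d u = s \<Longrightarrow> R_related d s u u"
  unfolding R_related_def by (intro exI[of _ "[u]"]) simp

lemma R_related_sym:
  assumes "R_related d s u v"
  shows "R_related d s v u"
proof -
  obtain zs where "zs \<noteq> []" "hd zs = u" "last zs = v" "set zs \<subseteq> fact_map d -` {s}"
    "successively (\<lambda>u v. supp u \<inter> supp v \<noteq> {}) zs"
    using assms by (auto simp: R_related_def)
  then show ?thesis unfolding R_related_def
    by (intro exI[of _ "rev zs"]) (simp add: hd_rev last_rev successively_rev Int_commute)
qed

lemma R_related_trans_step: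
  assumes "R_related d s u v" "fact_map d w = s" "supp v \<inter> supp w \<noteq> {}"
  shows "R_related d s u w"
proof -
  obtain zs where "zs \<noteq> []" "hd zs = u" "last zs = v" "set zs \<subseteq> fact_map d -` {s}"
    "successively (\<lambda>u v. supp u \<inter> supp v \<noteq> {}) zs"
    using assms by (auto simp: R_related_def)
  then show ?thesis unfolding R_related_def using assms(2,3)
    by (intro exI[of _ "zs @ [w]"]) (simp add: successively_append_iff)
qed

lemma R_related_trans:
  assumes "R_related d s u v" "R_related d s v w"
  shows "R_related d s u w"
proof -
  obtain zs where zs: "zs \<noteq> []" "hd zs = u" "last zs = v" "set zs \<subseteq> fact_map d -` {s}"
    "successively (\<lambda>u v. supp u \<inter> supp v \<noteq> {}) zs"
    using assms(1) by (auto simp: R_related_def)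
  obtain ws where ws: "ws \<noteq> []" "hd ws = v" "last ws = w" "set ws \<subseteq> fact_map d -` {s}"
    "successively (\<lambda>u v. supp u \<inter> supp v \<noteq> {}) ws"
    using assms(2) by (auto simp: R_related_def)
  show ?thesis
  \<comment> \<open>The shared endpoint \<open>v\<close> is kept only once: having it twice in a row
    would require \<open>supp v\<close> to meet itself, which fails for the zero
    factorization.\<close>
  proof (cases "tl ws = []")
    case True
    then have "v = w" using ws(1-3) by (cases ws) auto
    then show ?thesis using assms(1) by simp
  next
    case False
    then have "successively (\<lambda>u v. supp u \<inter> supp v \<noteq> {}) (zs @ tl ws)" "last (tl ws) = w"
      using zs ws by (cases ws; simp add: successively_append_iff successively_Cons)+
    moreover have "set (tl ws) \<subseteq> fact_map d -` {s}"
      using ws(1,4) by (cases ws) auto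
    ultimately show ?thesis unfolding R_related_def using zs False
      by (intro exI[of _ "zs @ tl ws"]) simp
  qed
qed

section \<open>Corners of the staircase\<close>

lemma UNIV_4: "(UNIV :: 4 set) = {0, 1, 2, 3}"
proof (rule sym, rule card_subset_eq)
  show "card {0, 1, 2, 3 :: 4} = card (UNIV :: 4 set)" by simp
qed simp_all

lemma fact_map_4: "fact_map d z = z 0 * d 0 + z 1 * d 1 + z 2 * d 2 + z 3 * d (3 :: 4)"
  unfolding fact_map_def UNIV_4 by simp

text \<open>Cubes play the role of factorizations without \<open>d 0\<close>, hence the recurring
  assumption \<open>z 0 = 0\<close>.\<close>

definition cube_of :: "(4 \<Rightarrow> nat) \<Rightarrow> cube" where
  "cube_of z = (z 1, z 2, z 3)"

lemma cube_label_cube_of: "z 0 = 0 \<Longrightarrow> cube_label d (cube_of z) = fact_map d z"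
  by (simp add: cube_label_def cube_of_def fact_map_4)

lemma cube_of_in_T_set_iff:
  assumes "z 0 = 0"
  shows "cube_of z \<in> T_set d a S \<longleftrightarrow>
    fact_map d z \<in> Apery S (d 0) \<and> (\<forall>i\<in>{1, 2, 3}. z i < a i i)"
  using cube_label_cube_of[of z d] assms
  by (simp add: T_set_def initial_cubes_def cube_of_def)

text \<open>Some point of \<open>V\<close> has a region containing the cube of \<open>z\<close> but
  none of its lower neighbours. So the point agrees with \<open>z\<close> wherever \<open>z\<close>
  is positive and is at most 0 elsewhere, where \<open>theta\<close> makes its contribution
  vanish.\<close>

lemma corner_in_U_set:
  assumes cuts: "cuts_out d V T" and "z 0 = 0"
    and out: "cube_of z \<notin> T"
    and pred: "\<And>i. i \<in> supp z \<Longrightarrow> cube_of (z(i := z i - 1)) \<in> T"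
  shows "int (fact_map d z) \<in> U_set d V"
proof -
  have T: "UNIV - (\<Union>v\<in>V. region v) = T"
    using cuts by (simp add: cuts_out_def initial_cubes_def)
  then obtain x1 x2 x3 where v: "(x1, x2, x3) \<in> V" "cube_of z \<in> region (x1, x2, x3)"
    using out by auto
  have le: "x1 \<le> int (z 1)" "x2 \<le> int (z 2)" "x3 \<le> int (z 3)"
    using v(2) by (auto simp: region_def cube_of_def)
  have "cube_of (z(i := z i - 1)) \<notin> region (x1, x2, x3)" if "z i > 0" for i
    using pred[of i] that v(1) T by (auto simp: supp_def)
  from this[of 1] this[of 2] this[of 3]
  have gt: "0 < z 1 \<Longrightarrow> x1 = int (z 1)" "0 < z 2 \<Longrightarrow> x2 = int (z 2)" "0 < z 3 \<Longrightarrow> x3 = int (z 3)"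
    using le by (auto simp: region_def cube_of_def)
  have "theta x * x = int n" if "x \<le> int n" "0 < n \<Longrightarrow> x = int n" for x n
    using that by (cases "n = 0") (auto simp: theta_def)
  note eq = this[OF le(1) gt(1)] this[OF le(2) gt(2)] this[OF le(3) gt(3)]
  have "int (fact_map d z) = theta x1 * x1 * int (d 1) + theta x2 * x2 * int (d 2)
      + theta x3 * x3 * int (d 3)"
    using \<open>z 0 = 0\<close> by (simp add: eq fact_map_4)
  then show ?thesis unfolding U_set_def using v(1) by force
qed

text \<open>Common last step of both cases of the theorem. It suffices that \<open>no0\<close>
  speaks of factorizations meeting \<open>supp z\<close>, so the label of \<open>z\<close> itself
  may lie outside the Apery set.\<close>

lemma factorization_in_U_set:
  assumes cuts: "cuts_out d V (T_set d a (range (fact_map d)))"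
    and "z 0 = 0"
    and out: "cube_of z \<notin> T_set d a (range (fact_map d))"
    and no0: "\<And>w. \<lbrakk>fact_map d w = fact_map d z; supp z \<inter> supp w \<noteq> {}\<rbrakk> \<Longrightarrow> w 0 = 0"
    and apos: "\<forall>i\<in>{1, 2, 3}. 0 < a i i"
    and small: "(\<forall>i\<in>{1, 2, 3}. z i < a i i) \<or> (\<exists>i. z = (\<lambda>_. 0)(i := a i i))"
  shows "int (fact_map d z) \<in> U_set d V"
proof (rule corner_in_U_set[where z = z, OF cuts \<open>z 0 = 0\<close> out])
  fix i assume "i \<in> supp z"
  then have zi: "0 < z i" by (simp add: supp_def)
  let ?y = "z(i := z i - 1)"
  have y: "fact_map d ?y + d i = fact_map d z"
    using fact_map_upd_diff[of 1 z i d] zi by simp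
  have "w 0 = 0" if "fact_map d w = fact_map d ?y" for w
  proof -
    \<comment> \<open>Restoring the removed copy of \<open>d i\<close> gives a factorization that
      meets \<open>z\<close> at \<open>i\<close>, so \<open>no0\<close> applies to it.\<close>
    have "fact_map d (w(i := w i + 1)) = fact_map d z"
      unfolding fact_map_upd_add using that y by simp
    moreover have "i \<in> supp z \<inter> supp (w(i := w i + 1))"
      using zi by (simp add: supp_def)
    ultimately have "(w(i := w i + 1)) 0 = 0" using no0 by blast
    then show ?thesis by (simp split: if_splits)
  qed
  then have "fact_map d ?y \<in> Apery (range (fact_map d)) (d 0)"
    by (auto simp: Apery_range_iff)
  moreover have "?y j < a j j" if j: "j \<in> {1, 2, 3}" for j
    using small
  proof
    assume "\<forall>i\<in>{1, 2, 3}. z i < a i i"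
    then have "z j < a j j" using j by blast
    then show ?thesis by auto
  next
    \<comment> \<open>Here \<open>i\<close> is the only index in the support, and lowering it by one
      brings it just below the bound.\<close>
    assume "\<exists>k. z = (\<lambda>_. 0)(k := a k k)"
    moreover have "0 < a j j" using apos j by blast
    ultimately show ?thesis using zi by (auto split: if_splits)
  qed
  moreover have "?y 0 = 0" using \<open>z 0 = 0\<close> by simp
  ultimately show "cube_of ?y \<in> T_set d a (range (fact_map d))"
    by (simp add: cube_of_in_T_set_iff)
qed

section \<open>Betti elements\<close>

text \<open>\<open>P\<close> abstracts a union of R-classes avoiding \<open>d 0\<close>. An exchange
  at \<open>i\<close> with \<open>a i 0 > 0\<close> would bring in \<open>d 0\<close>, so only an
  index \<open>k\<close> with \<open>a k 0 = 0\<close> needs care.\<close>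

lemma small_factorization_exists:
  fixes d :: "4 \<Rightarrow> nat"
  assumes rel: "\<forall>i\<in>{1, 2, 3}. minimal_relation d a i"
    and zeros: "card {i \<in> {1, 2, 3}. a i 0 = 0} \<le> 1"
    and closed: "\<And>u v. \<lbrakk>P u; fact_map d v = fact_map d u; supp u \<inter> supp v \<noteq> {}\<rbrakk> \<Longrightarrow> P v"
    and no0: "\<And>u. P u \<Longrightarrow> u 0 = 0"
    and ex: "P z"
  shows "\<exists>u. P u \<and> ((\<forall>i\<in>{1, 2, 3}. u i < a i i) \<or> (\<exists>i. u = (\<lambda>_. 0)(i := a i i)))"
proof -
  define Z where "Z = {i \<in> {1, 2, 3}. a i 0 = 0}"
  have "finite Z" unfolding Z_def by (rule finite_subset[of _ "{1, 2, 3}"]) auto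
  then have "\<forall>i\<in>Z. \<forall>j\<in>Z. i = j"
    using zeros by (simp only: Z_def[symmetric] card_le_Suc0_iff_eq One_nat_def)
  \<comment> \<open>If \<open>Z\<close> is empty, \<open>k\<close> is arbitrary.\<close>
  then obtain k where k: "Z \<subseteq> {k}" by blast
  \<comment> \<open>Minimality of \<open>u k\<close> replaces repeated exchange at \<open>k\<close>,
    since each exchange there would lower this coordinate.\<close>
  obtain u where u: "P u" "\<And>v. P v \<Longrightarrow> u k \<le> v k"
    using ex_has_least_nat[of P z "\<lambda>v. v k"] ex by blast
  have "u i < a i i" if i: "i \<in> {1, 2, 3}" and ne: "u \<noteq> (\<lambda>_. 0)(i := a i i)" for i
  proof (rule ccontr)
    assume "\<not> u i < a i i"
    then have le: "a i i \<le> u i" by simp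
    have reli: "minimal_relation d a i" using rel i by blast
    have ex: "P (exchange a i u)"
      using closed[OF u(1) fact_map_exchange[of d a i u, OF reli le] supp_exchange_Int[of a i u, OF le ne]] .
    have "i \<noteq> 0" using i by auto
    then have "a i 0 = 0" using no0[OF ex] by (simp add: exchange_def)
    then have "i = k" using i k unfolding Z_def by blast
    moreover have "0 < a i i" using reli by (simp add: minimal_relation_def)
    ultimately show False using u(2)[OF ex] le by (simp add: exchange_def)
  qed
  then show ?thesis using u(1) by blast
qed

text \<open>The factorization \<open>z'\<close> writes \<open>z i * d i\<close> without
  \<open>d i\<close>, so \<open>a i i \<le> z i\<close>. Were \<open>z\<close> different from the
  claimed vector, the exchange would stay in its class and hence use only \<open>i\<close>, forcing
  the right-hand side of the minimal relation to be 0.\<close>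

lemma singleton_class_eq:
  assumes rel: "minimal_relation d a i" and "0 < d i"
    and z: "supp z = {i}" and z': "fact_map d z' = fact_map d z" "z' i = 0"
    and cls: "\<And>u. R_related d (fact_map d z) z u \<Longrightarrow> supp u \<subseteq> {i}"
  shows "z = (\<lambda>_. 0)(i := a i i)"
proof (rule ccontr)
  assume ne: "z \<noteq> (\<lambda>_. 0)(i := a i i)"
  have zj: "0 < z j \<longleftrightarrow> j = i" for j using eqset_imp_iff[OF z, of j] by (simp add: supp_def)
  then have "0 < z i" by blast
  moreover have "z i * d i = (\<Sum>j\<in>UNIV - {i}. z' j * d j)"
  proof -
    have "(\<Sum>j\<in>UNIV - {i}. z j * d j) = 0" by (rule sum.neutral) (use zj in auto)
    then show ?thesis using z' fact_map_remove[of d z i] fact_map_remove[of d z' i] by simp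
  qed
  ultimately have le: "a i i \<le> z i" using rel unfolding minimal_relation_def by blast
  have "R_related d (fact_map d z) z (exchange a i z)"
    by (rule R_related_step)
      (use fact_map_exchange[of d a i z, OF rel le] supp_exchange_Int[of a i z, OF le ne] in auto)
  then have "supp (exchange a i z) \<subseteq> {i}" by (rule cls)
  then have "a i j = 0" if "j \<noteq> i" for j
    using that by (auto simp: supp_def exchange_def split: if_splits)
  then have "(\<Sum>j\<in>UNIV - {i}. a i j * d j) = 0" by (intro sum.neutral) simp
  then have "a i i * d i = 0" using rel by (simp only: minimal_relation_def)
  then show False using rel \<open>0 < d i\<close> by (simp add: minimal_relation_def)
qed

text \<open>Distinct R-classes use disjoint sets of indices. Two such sets inside
  \<open>{1, 2, 3}\<close> cannot both have two elements.\<close>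

lemma Betti_in_Apery_singleton_class:
  fixes d :: "4 \<Rightarrow> nat"
  assumes pos: "\<And>i. 0 < d i"
    and z: "fact_map d z = s" "fact_map d z' = s" "\<not> R_related d s z z'"
    and no0: "\<And>w. fact_map d w = s \<Longrightarrow> w 0 = 0"
  shows "\<exists>i\<in>{1, 2, 3}. \<exists>u v. fact_map d u = s \<and> fact_map d v = s \<and> supp u = {i} \<and> v i = 0 \<and>
    (\<forall>w. R_related d s u w \<longrightarrow> supp w \<subseteq> {i})"
proof -
  define C where "C u = \<Union>(supp ` {w. R_related d s u w})" for u
  have fib: "fact_map d w = s" if "R_related d s u w" for u w
    using that by (auto simp: R_related_def) (metis insertI1 last_in_set singletonD subset_iff vimageE)
  have self: "supp u \<subseteq> C u" if "fact_map d u = s" for u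
    using R_related_refl[OF that] by (auto simp: C_def)
  have sub: "C u \<subseteq> {1, 2, 3}" for u
  proof
    fix j assume "j \<in> C u"
    then obtain w where "R_related d s u w" "0 < w j" by (auto simp: C_def supp_def)
    then have "j \<noteq> 0" using no0[OF fib] by force
    then show "j \<in> {1, 2, 3}" using UNIV_4 UNIV_I[of j] by blast
  qed
  have disj: "C z \<inter> C z' = {}"
  proof (rule ccontr)
    assume "C z \<inter> C z' \<noteq> {}"
    then obtain u u' where u: "R_related d s z u" "R_related d s z' u'" "supp u \<inter> supp u' \<noteq> {}"
      by (auto simp: C_def)
    then have "R_related d s z u'" using R_related_trans_step fib by blast
    then show False using z(3) u(2) R_related_sym R_related_trans by blast
  qed
  \<comment> \<open>The zero factorization is alone in its fibre because the generators are
    positive.\<close>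
  have nonempty: "supp u \<noteq> {}" if "fact_map d u = s" "fact_map d v = s" "u \<noteq> v" for u v
  proof
    assume "supp u = {}"
    then have u0: "u j = 0" for j by (auto simp: supp_def)
    then have "fact_map d u = 0" by (simp add: fact_map_def)
    then have "fact_map d v = 0" using that by simp
    then have "v i * d i = 0" for i by (simp add: fact_map_remove[of d v i])
    then have "v i = 0" for i using pos[of i] by (metis less_irrefl mult_is_0)
    then show False using that u0 by (auto simp: fun_eq_iff)
  qed
  have "z \<noteq> z'" using z R_related_refl by blast
  then have ne: "supp z \<noteq> {}" "supp z' \<noteq> {}" using nonempty z by metis+
  have single: ?thesis if "fact_map d u = s" "fact_map d v = s" "supp u \<noteq> {}"
    "C u \<inter> C v = {}" "card (C u) \<le> 1" for u v
  proof -
    have "C u \<noteq> {}" "finite (C u)"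
      using that(3) self[OF that(1)] sub[of u] finite_subset by auto
    then have "card (C u) = 1" using that(5) by (metis card_0_eq le_antisym less_one not_le)
    then obtain i where i: "C u = {i}" by (rule card_1_singletonE)
    have "supp u = {i}" using self[OF that(1)] that(3) i by auto
    moreover have "v i = 0" using self[OF that(2)] that(4) i by (auto simp: supp_def)
    moreover have "\<forall>w. R_related d s u w \<longrightarrow> supp w \<subseteq> {i}" using i by (auto simp: C_def)
    moreover have "i \<in> {1, 2, 3}" using sub[of u] i by simp
    ultimately show ?thesis using that by blast
  qed
  have "finite (C z)" "finite (C z')" using sub finite_subset by auto
  then have "card (C z) + card (C z') = card (C z \<union> C z')" using disj by (simp add: card_Un_disjoint)
  also have "\<dots> \<le> card {1, 2, 3 :: 4}" by (rule card_mono) (use sub in auto)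
  also have "\<dots> = 3" by simp
  finally have "card (C z) \<le> 1 \<or> card (C z') \<le> 1" by linarith
  then show ?thesis
    using single[OF z(1,2) ne(1) disj] single[OF z(2,1) ne(2)] disj by (metis Int_commute)
qed

theorem theorem3p4:
  fixes d :: "4 \<Rightarrow> nat"
    and S :: "nat set"
    and a :: "4 \<Rightarrow> 4 \<Rightarrow> nat"
    and V :: "(int \<times> int \<times> int) set"
  assumes "numerical_semigroup_gens d S"
    and "\<forall>i \<in> {1, 2, 3}. minimal_relation d a i"
    and "card {i \<in> {1, 2, 3}. a i 0 = 0} \<le> 1"
    and "minimal_cuts_out d V (T_set d a S)"
  shows "int ` Betti d S \<subseteq> U_set d V"
proof
  have S: "S = range (fact_map d)" and pos: "\<And>i. 0 < d i"
    using assms(1) minimal_generators_pos[of d S]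
    by (auto simp: numerical_semigroup_gens_def minimal_generators_def)
  have cuts: "cuts_out d V (T_set d a (range (fact_map d)))"
    using assms(4) S by (simp add: minimal_cuts_out_def)
  have apos: "\<forall>i\<in>{1, 2, 3}. 0 < a i i"
    using assms(2) by (simp add: minimal_relation_def)
  fix t assume "t \<in> int ` Betti d S"
  then obtain s z z' where t: "t = int s"
    and z: "fact_map d z = s" "fact_map d z' = s" "\<not> R_related d s z z'"
    by (auto simp: Betti_def)
  show "t \<in> U_set d V"
  \<comment> \<open>By \<open>Apery_range_iff\<close>, this splits on whether \<open>s\<close> lies
    outside the Apery set.\<close>
  proof (cases "\<exists>w. fact_map d w = s \<and> 0 < w 0")
    case True
    then obtain w where w: "fact_map d w = s" "0 < w 0" by blast
    \<comment> \<open>All factorizations of \<open>s\<close> outside the class of \<open>w\<close>.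
      If neither \<open>z\<close> nor \<open>z'\<close> were among them, both would be related to
      \<open>w\<close> and hence to each other.\<close>
    define P where "P u \<longleftrightarrow> fact_map d u = s \<and> \<not> R_related d s u w" for u
    have "P z \<or> P z'" using z R_related_sym R_related_trans unfolding P_def by blast
    then obtain y where y: "P y" by blast
    have closed: "P v" if "P u" "fact_map d v = fact_map d u" "supp u \<inter> supp v \<noteq> {}" for u v
      using that R_related_step R_related_trans unfolding P_def by metis
    have no0: "u 0 = 0" if "P u" for u
    proof (rule ccontr)
      assume "u 0 \<noteq> 0"
      then have "0 \<in> supp u \<inter> supp w" using w(2) by (simp add: supp_def)
      then have "R_related d s u w"
        using that w(1) by (intro R_related_step) (auto simp: P_def)
      then show False using that by (simp add: P_def)
    qed
    have "\<exists>u. P u \<and> ((\<forall>i\<in>{1, 2, 3}. u i < a i i) \<or> (\<exists>i. u = (\<lambda>_. 0)(i := a i i)))"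
      by (rule small_factorization_exists[of d a P y]) (fact assms closed no0 y)+
    then obtain u where u: "P u"
      and small: "(\<forall>i\<in>{1, 2, 3}. u i < a i i) \<or> (\<exists>i. u = (\<lambda>_. 0)(i := a i i))"
      by blast
    have us: "fact_map d u = s" using u by (simp add: P_def)
    have "cube_of u \<notin> T_set d a (range (fact_map d))"
      using w us no0[OF u] by (auto simp: cube_of_in_T_set_iff Apery_range_iff)
    then have "int (fact_map d u) \<in> U_set d V"
      by (rule factorization_in_U_set[where z = u, OF cuts no0[OF u] _ _ apos small])
        (use closed[OF u] no0 in blast)
    then show ?thesis using us t by simp
  next
    case False
    then have no0: "w 0 = 0" if "fact_map d w = s" for w using that by auto
    have "\<exists>i\<in>{1, 2, 3}. \<exists>u v. fact_map d u = s \<and> fact_map d v = s \<and> supp u = {i} \<and> v i = 0 \<and>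
        (\<forall>w. R_related d s u w \<longrightarrow> supp w \<subseteq> {i})"
      by (rule Betti_in_Apery_singleton_class[of d z s z']) (fact pos z no0)+
    then obtain i u v where i: "i \<in> {1, 2, 3}" and u: "fact_map d u = s" "fact_map d v = s"
      "supp u = {i}" "v i = 0" "\<And>w. R_related d s u w \<Longrightarrow> supp w \<subseteq> {i}"
      by blast
    have "minimal_relation d a i" using assms(2) i by blast
    then have eq: "u = (\<lambda>_. 0)(i := a i i)"
      using u by (intro singleton_class_eq[OF _ pos, where z' = v]) auto
    \<comment> \<open>Although \<open>s\<close> is in the Apery set, coordinate \<open>i\<close>
      equals \<open>a i i\<close> and violates the strict bound in \<open>T_set\<close>.\<close>
    have "cube_of u \<notin> T_set d a (range (fact_map d))"
      using cube_of_in_T_set_iff[where z = u, OF no0[OF u(1)]] i eq by force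
    then have "int (fact_map d u) \<in> U_set d V"
      by (rule factorization_in_U_set[where z = u, OF cuts no0[OF u(1)] _ _ apos]) (use no0 u(1) eq in auto)
    then show ?thesis using u(1) t by simp
  qed
qed

end
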